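(* Let $\ell$ be a prime and let $N, K, \delta$ be positive integers. Let $A(q)=\sum_{n=0}^{\infty}\alpha(n)q^{n}$ and $B(q)=\sum_{m=0}^{\infty}\beta(m)q^{m}$ be formal power series in $\mathbb{Z}[[q]]$ such that $A(q)$ is periodic modulo $\ell^N$ with minimal period $\pi_{\ell^N}(A)=\delta K$, and such that $\beta(0)\equiv 1 \pmod{\ell^N}$ and $\beta(m)\equiv 0 \pmod{\ell^N}$ for all $m\not\equiv 0 \pmod{\delta}$. Define $$G(q):=A(q)\cdot B(q)=:\sum_{k=0}^{\infty}\lambda(k) q^{k}.$$ Fix positive integers $s, t$ and integers $0\leq a_{i},b_{j}\leq \delta-1$ for $1\leq i\leq s$, $1\leq j\leq t$. If $$\sum_{i=1}^{s}\lambda(\delta n+a_{i})\equiv\sum_{j=1}^{t} \lambda(\delta n+b_{j})\pmod{\ell^N}$$ holds for all $0\leq n < \pi_{\ell^N}(A)/\delta$, then it holds for all $n\geq 0$.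
   Context: A formal power series $A(q)=\sum_{n\ge 0}\alpha(n)q^n\in\mathbb{Z}[[q]]$ is called periodic (meaning purely periodic) with period $d$ modulo $M$, where $d, M$ are positive integers, if $\alpha(n+d)\equiv\alpha(n)\pmod{M}$ for all $n\ge 0$. The smallest such positive integer $d$ is the minimal period of $A(q)$ modulo $M$, denoted $\pi_M(A)$. *)

theory Defs
  imports
    "HOL-Computational_Algebra.Formal_Power_Series"
    "HOL-Number_Theory.Cong"
begin

definition periodic_mod :: "nat \<Rightarrow> int fps \<Rightarrow> nat \<Rightarrow> bool" where
  "periodic_mod M A d \<longleftrightarrow>
     d > 0 \<and> (\<forall>n. [fps_nth A (n + d) = fps_nth A n] (mod int M))"

text \<open>Unspecified unless \<open>A\<close> is periodic modulo \<open>M\<close> with some period.\<close>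

definition min_period :: "nat \<Rightarrow> int fps \<Rightarrow> nat" where
  "min_period M A = (LEAST d. periodic_mod M A d)"

end

theory Submission
  imports Defs
begin

text \<open>
  Modulo \<open>\<ell>\<^sup>N\<close> the series \<open>B\<close> only involves powers of \<open>q\<^sup>\<delta>\<close>, so multiplication by \<open>B\<close>
  acts on each residue class of exponents modulo \<open>\<delta>\<close> separately. Hence the difference of the
  two sides for \<open>G\<close> is the convolution of \<open>\<beta>(\<delta>n)\<close> with the corresponding difference for
  \<open>A\<close>. As \<open>\<beta>(0)\<close> is \<open>1\<close>, this convolution is unitriangular: vanishing for \<open>n < K\<close>
  transfers to \<open>A\<close>, extends to all \<open>n\<close> by periodicity, and transfers back to \<open>G\<close>.
\<close>

lemma periodic_mod_min_period:
  assumes "periodic_mod M A d"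
  shows "periodic_mod M A (min_period M A)"
  using assms unfolding min_period_def by (rule LeastI)

text \<open>In the Cauchy product only the coefficients of \<open>B\<close> at multiples of
  \<open>\<delta>\<close> survive modulo \<open>M\<close>. Since \<open>r < \<delta>\<close>, the
  multiples of \<open>\<delta>\<close> up to \<open>\<delta> * n + r\<close> are exactly the
  \<open>\<delta> * j\<close> with \<open>j \<le> n\<close>, and subtracting one of them keeps the
  residue \<open>r\<close>.\<close>

lemma fps_mult_nth_section_cong:
  fixes A B :: "int fps" and M :: int
  assumes "r < \<delta>"
    and B: "\<And>m. \<not> \<delta> dvd m \<Longrightarrow> [fps_nth B m = 0] (mod M)"
  shows "[fps_nth (A * B) (\<delta> * n + r) =
    (\<Sum>j\<le>n. fps_nth B (\<delta> * j) * fps_nth A (\<delta> * (n - j) + r))] (mod M)"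
proof -
  let ?k = "\<delta> * n + r"
  let ?f = "\<lambda>i. fps_nth B i * fps_nth A (?k - i)"
  let ?S = "(\<lambda>j. \<delta> * j) ` {..n}"
  have "\<delta> > 0" using \<open>r < \<delta>\<close> by simp
  have sub: "?S \<subseteq> {0..?k}"
    by (auto intro: le_trans[OF mult_le_mono2 le_add1])
  have zero: "[?f i = 0] (mod M)" if "i \<in> {0..?k} - ?S" for i
  proof -
    have "\<not> \<delta> dvd i"
    proof
      assume "\<delta> dvd i"
      then obtain j where j: "i = \<delta> * j" by blast
      then have "\<delta> * j < \<delta> * Suc n" using that \<open>r < \<delta>\<close> by auto
      then have "j < Suc n" unfolding mult_less_cancel1 ..
      then have "j \<le> n" by simp
      then show False using that j by auto
    qed
    from cong_mult[OF B[OF this] cong_refl] show ?thesis by simp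
  qed
  have "fps_nth (A * B) ?k = (\<Sum>i=0..?k. ?f i)"
    \<comment> \<open>Commuting the factors makes the summation index the exponent in
      \<open>B\<close>, the series whose support is restricted.\<close>
    by (subst mult.commute) (simp add: fps_mult_nth)
  also have "\<dots> = (\<Sum>i\<in>{0..?k} - ?S. ?f i) + (\<Sum>i\<in>?S. ?f i)"
    by (rule sum.subset_diff[OF sub]) simp
  finally have split: "fps_nth (A * B) ?k =
    (\<Sum>i\<in>{0..?k} - ?S. ?f i) + (\<Sum>i\<in>?S. ?f i)" .
  have cong: "[(\<Sum>i\<in>{0..?k} - ?S. ?f i) + (\<Sum>i\<in>?S. ?f i) = (\<Sum>i\<in>{0..?k} - ?S. 0) + (\<Sum>i\<in>?S. ?f i)] (mod M)"
    by (intro cong_add cong_sum zero cong_refl)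
  have "(\<Sum>i\<in>{0..?k} - ?S. 0) + (\<Sum>i\<in>?S. ?f i) = (\<Sum>j\<le>n. ?f (\<delta> * j))"
    using \<open>\<delta> > 0\<close> by (subst sum.reindex) (auto simp: inj_on_def)
  also have "\<dots> = (\<Sum>j\<le>n. fps_nth B (\<delta> * j) * fps_nth A (\<delta> * (n - j) + r))"
    by (rule sum.cong) (auto simp: diff_mult_distrib2)
  finally show ?thesis
    using cong unfolding split by (rule subst)
qed

text \<open>Strong induction: every summand with \<open>j > 0\<close> contains an earlier value of
  \<open>c\<close>, already zero modulo \<open>M\<close>, so \<open>L n\<close> reduces to
  \<open>b 0 * c n\<close>, that is, to \<open>c n\<close>.\<close>

lemma unitriangular_convolution_cong_0:
  fixes c b L :: "nat \<Rightarrow> int"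
  assumes L: "\<And>n. [L n = (\<Sum>j\<le>n. b j * c (n - j))] (mod M)"
    and b0: "[b 0 = 1] (mod M)"
    and L0: "\<And>n. n < K \<Longrightarrow> [L n = 0] (mod M)"
    and "n < K"
  shows "[c n = 0] (mod M)"
  using \<open>n < K\<close>
proof (induction n rule: less_induct)
  case (less n)
  have zero: "[b j * c (n - j) = 0] (mod M)" if "j \<in> {..n} - {0}" for j
  proof -
    have "[c (n - j) = 0] (mod M)" using that less by auto
    from cong_mult[OF cong_refl this] show ?thesis by simp
  qed
  have "(\<Sum>j\<le>n. b j * c (n - j)) = b 0 * c n + (\<Sum>j\<in>{..n} - {0}. b j * c (n - j))"
    by (subst sum.remove[of _ 0]) auto
  also have "[\<dots> = 1 * c n + (\<Sum>j\<in>{..n} - {0}. 0)] (mod M)"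
    by (intro cong_add cong_mult cong_sum b0 zero cong_refl)
  finally have "[(\<Sum>j\<le>n. b j * c (n - j)) = c n] (mod M)"
    by simp
  with L have "[L n = c n] (mod M)"
    by (rule cong_trans)
  from cong_trans[OF cong_sym[OF this] L0[OF less.prems]] show ?case .
qed

text \<open>The first \<open>K\<close> values of \<open>L\<close> force a full period of
  \<open>c\<close> to vanish, hence all of \<open>c\<close>, hence every summand of the
  convolution.\<close>

lemma convolution_periodic_cong_0:
  fixes c b L :: "nat \<Rightarrow> int"
  assumes L: "\<And>n. [L n = (\<Sum>j\<le>n. b j * c (n - j))] (mod M)"
    and b0: "[b 0 = 1] (mod M)"
    and L0: "\<And>n. n < K \<Longrightarrow> [L n = 0] (mod M)"
    and "K > 0"
    and per: "\<And>n. [c (n + K) = c n] (mod M)"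
  shows "[L n = 0] (mod M)"
proof -
  have c: "[c m = 0] (mod M)" for m
  proof (induction m rule: less_induct)
    case (less m)
    show ?case
    proof (cases "m < K")
      case True
      with L b0 L0 show ?thesis by (rule unitriangular_convolution_cong_0)
    next
      case False
      then have "[c (m - K) = 0] (mod M)" using less \<open>K > 0\<close> by simp
      moreover have "[c m = c (m - K)] (mod M)" using per[of "m - K"] False by simp
      ultimately show ?thesis by (metis cong_trans)
    qed
  qed
  have "[(\<Sum>j\<le>n. b j * c (n - j)) = (\<Sum>j\<le>n. b j * 0)] (mod M)"
    by (intro cong_sum cong_mult c cong_refl)
  with L have "[L n = (\<Sum>j\<le>n. b j * 0)] (mod M)" by (rule cong_trans)
  then show ?thesis by simp
qed

theorem theorem1p3:
  fixes l N K \<delta> s t :: nat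
    and A B G :: "int fps"
    and a b :: "nat \<Rightarrow> nat"
  assumes "prime l"
    and "N > 0" and "K > 0" and "\<delta> > 0"
    and "\<exists>d. periodic_mod (l ^ N) A d"
    and "min_period (l ^ N) A = \<delta> * K"
    and "[fps_nth B 0 = 1] (mod int (l ^ N))"
    and "\<And>m. \<not> [m = 0] (mod \<delta>) \<Longrightarrow> [fps_nth B m = 0] (mod int (l ^ N))"
    and "G = A * B"
    and "s > 0" and "t > 0"
    and "\<And>i. i \<in> {1..s} \<Longrightarrow> a i \<le> \<delta> - 1"
    and "\<And>j. j \<in> {1..t} \<Longrightarrow> b j \<le> \<delta> - 1"
    and "\<And>n. n < min_period (l ^ N) A div \<delta> \<Longrightarrow>
           [(\<Sum>i=1..s. fps_nth G (\<delta> * n + a i)) =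
            (\<Sum>j=1..t. fps_nth G (\<delta> * n + b j))] (mod int (l ^ N))"
  shows "\<forall>n. [(\<Sum>i=1..s. fps_nth G (\<delta> * n + a i)) =
              (\<Sum>j=1..t. fps_nth G (\<delta> * n + b j))] (mod int (l ^ N))"
proof
  fix n
  let ?M = "int (l ^ N)"
  let ?D = "\<lambda>F n. (\<Sum>i=1..s. fps_nth F (\<delta> * n + a i)) - (\<Sum>j=1..t. fps_nth F (\<delta> * n + b j))"
  have B: "[fps_nth B m = 0] (mod ?M)" if "\<not> \<delta> dvd m" for m
    using assms(8) that by (simp add: cong_0_iff)
  \<comment> \<open>The existence of some period guarantees that the \<open>LEAST\<close> in
    \<open>min_period\<close> is attained and is itself a period.\<close>
  have "periodic_mod (l ^ N) A (\<delta> * K)"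
    using assms(5,6) periodic_mod_min_period by metis
  then have per: "[fps_nth A (m + \<delta> * K) = fps_nth A m] (mod ?M)" for m
    unfolding periodic_mod_def by blast
  \<comment> \<open>Moving \<open>n\<close> by \<open>K\<close> moves the exponent by
    \<open>\<delta> * K\<close>, so every section of \<open>A\<close> has period
    \<open>K\<close>.\<close>
  have A: "[fps_nth A (\<delta> * (n + K) + r) = fps_nth A (\<delta> * n + r)] (mod ?M)" for n r
    using per[of "\<delta> * n + r"] by (simp add: distrib_left add.assoc add.commute[of r])
  have "[?D G n = 0] (mod ?M)"
  proof (rule convolution_periodic_cong_0[where L = "?D G" and b = "\<lambda>j. fps_nth B (\<delta> * j)" and c = "?D A" and K = K])
    show "[?D G n = (\<Sum>j\<le>n. fps_nth B (\<delta> * j) * ?D A (n - j))] (mod ?M)" for n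
    proof -
      have r: "[fps_nth G (\<delta> * n + r) =
          (\<Sum>j\<le>n. fps_nth B (\<delta> * j) * fps_nth A (\<delta> * (n - j) + r))] (mod ?M)"
        if "r \<le> \<delta> - 1" for r
        unfolding \<open>G = A * B\<close> using that \<open>\<delta> > 0\<close> B
        by (intro fps_mult_nth_section_cong) auto
      have "[?D G n =
          (\<Sum>i=1..s. \<Sum>j\<le>n. fps_nth B (\<delta> * j) * fps_nth A (\<delta> * (n - j) + a i)) -
          (\<Sum>i=1..t. \<Sum>j\<le>n. fps_nth B (\<delta> * j) * fps_nth A (\<delta> * (n - j) + b i))] (mod ?M)"
        by (intro cong_diff cong_sum r assms(12,13))
      \<comment> \<open>Both double sums carry the same weights
        \<open>fps_nth B (\<delta> * j)\<close>, whatever the offsets \<open>a i\<close> and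
        \<open>b i\<close>; interchanging the sums and factoring these out leaves one
        convolution.\<close>
      moreover have "(\<Sum>i=1..s. \<Sum>j\<le>n. fps_nth B (\<delta> * j) * fps_nth A (\<delta> * (n - j) + a i)) -
          (\<Sum>i=1..t. \<Sum>j\<le>n. fps_nth B (\<delta> * j) * fps_nth A (\<delta> * (n - j) + b i)) =
          (\<Sum>j\<le>n. fps_nth B (\<delta> * j) * ?D A (n - j))"
        by (simp only: sum.swap[of _ "{..n}"] sum_distrib_left right_diff_distrib sum_subtractf)
      ultimately show ?thesis by (simp only:)
    qed
    show "[fps_nth B (\<delta> * 0) = 1] (mod ?M)" using assms(7) by simp
    \<comment> \<open>The range assumed in the theorem is \<open>n < K\<close>, because
      \<open>\<delta> * K div \<delta> = K\<close>.\<close>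
    show "[?D G n = 0] (mod ?M)" if "n < K" for n
      using assms(14)[of n] that assms(6) \<open>\<delta> > 0\<close> by (simp add: cong_diff_iff_cong_0)
    show "[?D A (n + K) = ?D A n] (mod ?M)" for n
      by (intro cong_diff cong_sum A)
  qed (rule \<open>K > 0\<close>)
  then show "[(\<Sum>i=1..s. fps_nth G (\<delta> * n + a i)) =
      (\<Sum>j=1..t. fps_nth G (\<delta> * n + b j))] (mod ?M)"
    by (simp add: cong_diff_iff_cong_0)
qed

end
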